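(* For $q$ a prime power and $p$ a prime, consider the ratio $|T_q^p|/q^{q^p}$. Then: (i) for every fixed prime power $q$, $\displaystyle\lim_{p\to\infty}\frac{|T_q^p|}{q^{q^p}}=1$, where $p$ runs over the primes; (ii) for every fixed prime $p$, $\displaystyle\lim_{q\to\infty}\frac{|T_q^p|}{q^{q^p}}=0$, where $q$ runs over the prime powers.
   Context: For a prime power $q$ and a natural number $m\ge1$, a map $f:\mathbb{F}_{q^m}\to\mathbb{F}_{q^m}$ is called subfield preserving if $f(\mathbb{F}_q)\subseteq\mathbb{F}_q$ and, for all positive divisors $d,s$ of $m$, $f(\mathbb{F}_{q^d}\setminus\mathbb{F}_{q^s})\subseteq\mathbb{F}_{q^d}\setminus\mathbb{F}_{q^s}$. $T_q^m$ denotes the set of subfield preserving maps $f:\mathbb{F}_{q^m}\to\mathbb{F}_{q^m}$ whose polynomial representation (the unique polynomial of degree less than $q^m$ inducing $f$) has coefficients in $\mathbb{F}_q$. Here $m=p$. Note that $q^{q^p}=|\mathbb{F}_q[x]/(x^{q^p}-x)|$. *)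

theory Defs
  imports
    Complex_Main
    "HOL-Algebra.Polynomials"
    "HOL-Number_Theory.Prime_Powers"
begin

text \<open>
  A finite field has at most one subfield of any given cardinality. If \<open>R\<close> is a field with
  \<open>q ^ m\<close> elements and \<open>d\<close> divides \<open>m\<close>, then \<open>subfield_of_card R (q ^ d)\<close> is the copy of
  the field with \<open>q ^ d\<close> elements inside \<open>R\<close>; the description is not used for other cardinalities.
\<close>

definition subfield_of_card :: "('a, 'b) ring_scheme \<Rightarrow> nat \<Rightarrow> 'a set" where
  "subfield_of_card R n = (THE K. subfield K R \<and> card K = n)"

definition subfield_preserving ::
    "('a, 'b) ring_scheme \<Rightarrow> nat \<Rightarrow> nat \<Rightarrow> ('a \<Rightarrow> 'a) \<Rightarrow> bool" where
  "subfield_preserving R q m f \<longleftrightarrow>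
     f ` subfield_of_card R q \<subseteq> subfield_of_card R q \<and>
     (\<forall>d s. 0 < d \<and> 0 < s \<and> d dvd m \<and> s dvd m \<longrightarrow>
        f ` (subfield_of_card R (q ^ d) - subfield_of_card R (q ^ s))
          \<subseteq> subfield_of_card R (q ^ d) - subfield_of_card R (q ^ s))"

text \<open>
  Polynomials are normalized coefficient lists, leading coefficient first, so that
  \<open>length P \<le> n\<close> says that \<open>P\<close> is zero or has degree less than \<open>n\<close>, and \<open>set P\<close> is the set
  of its coefficients (up to zero coefficients).
\<close>

definition poly_representation :: "('a, 'b) ring_scheme \<Rightarrow> ('a \<Rightarrow> 'a) \<Rightarrow> 'a list" where
  "poly_representation R f =
     (THE P. P \<in> carrier (univ_poly R (carrier R)) \<and> length P \<le> order R \<and>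
             (\<forall>x\<in>carrier R. ring.eval R P x = f x))"

text \<open>
  Maps on the field \<open>R\<close> with \<open>q ^ m\<close> elements are taken extensional (\<open>undefined\<close> off the carrier),
  so that each map of the carrier into itself is counted once.
\<close>

definition subfield_preserving_maps ::
    "('a, 'b) ring_scheme \<Rightarrow> nat \<Rightarrow> nat \<Rightarrow> ('a \<Rightarrow> 'a) set" where
  "subfield_preserving_maps R q m =
     {f \<in> carrier R \<rightarrow>\<^sub>E carrier R.
        subfield_preserving R q m f \<and> set (poly_representation R f) \<subseteq> subfield_of_card R q}"

end

theory Submission
  imports
    Defs
    "HOL-Algebra.Polynomial_Divisibility"
    "HOL-Algebra.Multiplicative_Group"
    "HOL-Number_Theory.Residues"
    "HOL-Real_Asymp.Real_Asymp"
begin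

text \<open>
  The coefficients of a map \<open>f\<close> on the field \<open>F\<close> with \<open>q ^ p\<close> elements lie in the subfield \<open>K\<close> with
  \<open>q\<close> elements if and only if \<open>f\<close> commutes with the Frobenius map \<open>\<phi> x = x ^ q\<close>: replacing each
  coefficient by its \<open>q\<close>-th power yields a polynomial that represents the conjugate of \<open>f\<close> by \<open>\<phi>\<close>.
  Now \<open>\<phi>\<close> fixes \<open>K\<close> pointwise and, \<open>p\<close> being prime, has only orbits of length \<open>p\<close> on \<open>F - K\<close>. So \<open>f\<close> is arbitrary
  on \<open>K\<close> and, on \<open>F - K\<close>, is determined by arbitrary values in \<open>F - K\<close> at one point of each orbit.
  Hence there are \<open>q ^ q * (q ^ p - q) ^ k\<close> such maps, where \<open>k = (q ^ p - q) / p\<close>, and the ratio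
  is \<open>(1 - q / q ^ p) ^ k\<close>. This is at least \<open>1 - q / p\<close> by Bernoulli's inequality and at most
  \<open>exp (- (q - 1) / p)\<close>.
\<close>

section \<open>The binomial theorem and additivity of prime powers\<close>

lemma (in cring) binomial_expansion:
  assumes x: "x \<in> carrier R" and y: "y \<in> carrier R"
  shows "(x \<oplus> y) [^] (n::nat) = (\<Oplus>k\<in>{..n}. [(n choose k)] \<cdot> (x [^] k \<otimes> y [^] (n - k)))"
proof (induction n)
  case 0
  show ?case using x y by simp
next
  case (Suc n)
  let ?t = "\<lambda>n k. [(n choose k)] \<cdot> (x [^] k \<otimes> y [^] (n - k))"
  \<comment> \<open>After an index shift both \<open>?S \<otimes> x\<close> and
    \<open>?S \<otimes> y\<close> consist of the monomials
    \<open>x [^] Suc k \<otimes> y [^] (n - k)\<close>, so that Pascal's rule adds \<open>?A\<close>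
    and \<open>?B\<close> termwise.\<close>
  let ?u = "\<lambda>c k. [(c::nat)] \<cdot> (x [^] Suc k \<otimes> y [^] (n - k))"
  let ?S = "\<Oplus>k\<in>{..n}. ?t n k"
  let ?A = "\<Oplus>k\<in>{..n}. ?u (n choose k) k"
  let ?B = "\<Oplus>k\<in>{..n}. ?u (n choose Suc k) k"
  have t: "?t n k \<in> carrier R" for n k using x y by simp
  have u: "?u c k \<in> carrier R" for c k using x y by simp
  have sx: "?S \<otimes> x = ?A"
  proof -
    have "?S \<otimes> x = (\<Oplus>k\<in>{..n}. ?t n k \<otimes> x)"
      using x t by (intro finsum_ldistr) auto
    also have "\<dots> = ?A"
      using x y u by (intro add.finprod_cong') (auto simp: add_pow_ldistr add_pow_rdistr m_ac)
    finally show ?thesis .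
  qed
  have sy: "?S \<otimes> y = y [^] Suc n \<oplus> ?B"
  proof -
    have "?S \<otimes> y = (\<Oplus>k\<in>{..n}. ?t n k \<otimes> y)"
      using y t by (intro finsum_ldistr) auto
    also have "\<dots> = (\<Oplus>k\<in>{..n}. [(n choose k)] \<cdot> (x [^] k \<otimes> y [^] (Suc n - k)))"
      using x y by (intro add.finprod_cong') (auto simp: add_pow_ldistr add_pow_rdistr m_ac Suc_diff_le)
    \<comment> \<open>The added index contributes zero, as \<open>n choose Suc n\<close> is 0; then
      the term at index 0 is split off and the others are shifted.\<close>
    also have "\<dots> = (\<Oplus>k\<in>{..Suc n}. [(n choose k)] \<cdot> (x [^] k \<otimes> y [^] (Suc n - k)))"
      using x y by (simp add: finsum_Suc binomial_eq_0)
    also have "\<dots> = y [^] Suc n \<oplus> ?B"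
      using x y by (subst finsum_Suc2) (auto simp: a_comm)
    finally show ?thesis .
  qed
  have "(\<Oplus>k\<in>{..Suc n}. ?t (Suc n) k) = y [^] Suc n \<oplus> (\<Oplus>k\<in>{..n}. ?t (Suc n) (Suc k))"
    using x y by (subst finsum_Suc2) (auto simp: a_comm)
  also have "(\<Oplus>k\<in>{..n}. ?t (Suc n) (Suc k)) = (\<Oplus>k\<in>{..n}. ?u (n choose k) k \<oplus> ?u (n choose Suc k) k)"
    using x y by (intro add.finprod_cong') (auto simp: add.nat_pow_mult)
  also have "\<dots> = ?A \<oplus> ?B"
    using u by (intro finsum_addf) auto
  also have "y [^] Suc n \<oplus> (?A \<oplus> ?B) = ?A \<oplus> (y [^] Suc n \<oplus> ?B)"
    using u y by (intro a_lcomm) (auto intro!: finsum_closed)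
  also have "\<dots> = ?S \<otimes> (x \<oplus> y)"
    using x y t sx sy r_distr[of x y ?S] by simp
  also have "\<dots> = (x \<oplus> y) [^] Suc n"
    using Suc by simp
  finally show ?case by simp
qed

lemma (in cring) add_pow_eq_zero_of_dvd:
  assumes "[r] \<cdot> \<one> = \<zero>" "r dvd (n::nat)" "x \<in> carrier R"
  shows "[n] \<cdot> x = \<zero>"
proof -
  obtain c where c: "n = r * c" using assms by auto
  have "[n] \<cdot> x = [n] \<cdot> (\<one> \<otimes> x)" using assms by simp
  also have "\<dots> = ([n] \<cdot> \<one>) \<otimes> x" using assms by (simp only: add_pow_ldistr one_closed)
  also have "[n] \<cdot> \<one> = [c] \<cdot> ([r] \<cdot> \<one>)" using c by (simp add: add.nat_pow_pow)
  finally show ?thesis using assms by simp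
qed

text \<open>A prime \<open>r\<close> divides every inner binomial coefficient, so only the two outer
  terms of the expansion survive.\<close>

lemma (in cring) freshmans_dream:
  assumes r: "Factorial_Ring.prime r" and char: "[r] \<cdot> \<one> = \<zero>"
    and x: "x \<in> carrier R" and y: "y \<in> carrier R"
  shows "(x \<oplus> y) [^] (r::nat) = x [^] r \<oplus> y [^] r"
proof -
  \<comment> \<open>In this form the indices 0 and \<open>r\<close> can both be split off, which
    leaves the inner indices \<open>Suc k\<close> with \<open>k \<le> n\<close>.\<close>
  obtain n where n: "r = Suc (Suc n)"
    using prime_ge_2_nat[OF r] by (metis add_2_eq_Suc le_Suc_ex)
  let ?t = "\<lambda>k. [(r choose k)] \<cdot> (x [^] k \<otimes> y [^] (r - k))"
  have "?t (Suc k) = \<zero>" if "k \<le> n" for k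
    using that n x y r char by (intro add_pow_eq_zero_of_dvd[OF char] dvd_choose_prime) auto
  then have "(\<Oplus>k\<in>{..n}. ?t (Suc k)) = \<zero>"
    by (intro add.finprod_one_eqI) (auto)
  then have "(\<Oplus>k\<in>{..Suc n}. ?t k) = y [^] r"
    using x y by (subst finsum_Suc2) auto
  then have "(\<Oplus>k\<in>{..r}. ?t k) = x [^] r \<oplus> y [^] r"
    using x y unfolding n by (subst finsum_Suc) auto
  then show ?thesis using binomial_expansion[OF x y] by simp
qed

lemma (in domain) nat_pow_eq_zero_imp:
  assumes "x \<in> carrier R" "x [^] (n::nat) = \<zero>"
  shows "x = \<zero>"
  using assms(2) by (induction n) (use assms(1) integral in auto)

text \<open>Lagrange's theorem in the additive group kills \<open>[(r ^ k)] \<cdot> \<one>\<close>,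
  which is the \<open>k\<close>-th power of \<open>[r] \<cdot> \<one>\<close>; a domain has no
  nonzero nilpotent elements.\<close>

lemma (in domain) add_pow_one_eq_zero_of_order_power:
  assumes "order R = r ^ k" "0 < k"
  shows "[r] \<cdot> \<one> = \<zero>"
proof -
  have pow: "([r] \<cdot> \<one>) [^] n = [(r ^ n)] \<cdot> \<one>" for n
  proof (induction n)
    case (Suc n)
    then show ?case
      by (simp add: add_pow_ldistr add_pow_rdistr add.nat_pow_pow mult.commute)
  qed simp
  have "[(order R)] \<cdot> \<one> = \<zero>"
    using add.pow_order_eq_1[of \<one>] by (simp add: order_def)
  then have "([r] \<cdot> \<one>) [^] k = \<zero>" using pow assms by simp
  then show ?thesis by (rule nat_pow_eq_zero_imp[rotated]) simp
qed

section \<open>The Frobenius map and its fixed field\<close>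

locale finite_field_extension = field R for R (structure) +
  fixes q m :: nat
  assumes primepow_q: "primepow q" and m_pos: "0 < m" and order_R: "order R = q ^ m"
begin

text \<open>The base field is not given as data: it is recovered as the set of fixed points of the
  Frobenius map.\<close>

definition K where "K = {x \<in> carrier R. x [^] q = x}"

lemma q_ge_2: "2 \<le> q"
  using primepow_q primepow_gt_Suc_0[of q] by simp

lemma finite_carrier: "finite (carrier R)"
  using order_R q_ge_2 order_gt_0_iff_finite by (metis gr0I less_le_trans pos2 power_eq_0_iff not_numeral_le_zero)

text \<open>With \<open>q = r ^ k\<close> and \<open>r\<close> prime, the map is the
  \<open>k\<close>-fold iterate of the \<open>r\<close>-th power map, which is additive in
  characteristic \<open>r\<close>.\<close>

lemma frobenius_hom: "(\<lambda>x. x [^] q) \<in> ring_hom R R"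
proof -
  obtain r k where r: "Factorial_Ring.prime r" "0 < k" "q = r ^ k"
    using primepow_q by (auto simp: primepow_def)
  have "order R = r ^ (k * m)" using order_R r by (simp add: power_mult)
  then have char: "[r] \<cdot> \<one> = \<zero>"
    using r m_pos by (intro add_pow_one_eq_zero_of_order_power[of r "k * m"]) auto
  have add: "(x \<oplus> y) [^] (r ^ j) = x [^] (r ^ j) \<oplus> y [^] (r ^ j)"
    if "x \<in> carrier R" "y \<in> carrier R" for x y j
  proof (induction j)
    case (Suc j)
    have "(x \<oplus> y) [^] (r ^ Suc j) = ((x \<oplus> y) [^] (r ^ j)) [^] r"
      using that by (simp add: nat_pow_pow mult.commute)
    also have "\<dots> = (x [^] (r ^ j)) [^] r \<oplus> (y [^] (r ^ j)) [^] r"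
      unfolding Suc using that by (intro freshmans_dream r char) auto
    finally show ?case using that by (simp add: nat_pow_pow mult.commute)
  qed (use that in simp)
  show ?thesis
    using add r by (intro ring_hom_memI) (auto simp: nat_pow_distrib)
qed

lemma frobenius_ring_hom_ring: "ring_hom_ring R R (\<lambda>x. x [^] q)"
  by (intro ring_hom_ringI2 ring_axioms frobenius_hom)

lemma subfield_K: "subfield K R"
proof -
  interpret h: ring_hom_ring R R "\<lambda>x. x [^] q" by (rule frobenius_ring_hom_ring)
  show ?thesis
  proof (rule subfieldI')
    show "subring K R"
      by (rule subringI) (auto simp: K_def nat_pow_distrib h.hom_add)
    fix k assume "k \<in> K - {\<zero>}"
    then have k: "k \<in> Units R" "k [^] q = k" by (auto simp: K_def field_Units)
    \<comment> \<open>Since \<open>k [^] q = k\<close>, the \<open>q\<close>-th power of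
      \<open>inv k\<close> is again an inverse of \<open>k\<close>, and inverses are unique.\<close>
    then have "inv k [^] q \<otimes> k = inv k [^] q \<otimes> k [^] q" by simp
    also have "\<dots> = (inv k \<otimes> k) [^] q"
      using k by (intro nat_pow_distrib[symmetric]) auto
    also have "\<dots> = \<one>" using k by simp
    finally have "inv k [^] q = inv k"
      using k by (metis Units_closed Units_inv_closed inv_unique' m_comm nat_pow_closed)
    then show "inv k \<in> K" using k by (simp add: K_def)
  qed
qed

text \<open>Lagrange's theorem in the multiplicative group of \<open>L\<close> gives the exponent
  \<open>card L - 1\<close>; one more factor \<open>x\<close> makes the identity true at zero as
  well.\<close>

lemma pow_card_subfield:
  assumes "subfield L R" "x \<in> L"
  shows "x [^] card L = x"
proof -
  have sub: "L \<subseteq> carrier R" and zero: "\<zero> \<in> L"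
    using subfieldE(3)[OF assms(1)] subringE(2)[OF subfieldE(1)[OF assms(1)]] by auto
  then have fin: "finite L" using finite_carrier finite_subset by blast
  have card: "card L = Suc (card (L - {\<zero>}))" using fin zero by (metis card.remove)
  show ?thesis
  proof (cases "x = \<zero>")
    case True
    then show ?thesis unfolding card by simp
  next
    case False
    interpret G: group "Multiplicative_Group.mult_of R" by (rule field_mult_group)
    interpret H: group "Multiplicative_Group.mult_of R \<lparr>carrier := L - {\<zero>}\<rparr>"
      by (rule G.subgroup_imp_group[OF subgroup_mult_of[OF assms(1)]])
    have "x [^]\<^bsub>Multiplicative_Group.mult_of R \<lparr>carrier := L - {\<zero>}\<rparr>\<^esub> card (L - {\<zero>}) = \<one>"
      using H.pow_order_eq_1[of x] False assms by (simp add: order_def)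
    then have "x [^] card (L - {\<zero>}) = \<one>"
      by (simp add: G.nat_pow_consistent[symmetric] Multiplicative_Group.nat_pow_mult_of)
    then have "x [^] Suc (card (L - {\<zero>})) = x" using assms(2) sub by auto
    then show ?thesis by (simp only: card)
  qed
qed

text \<open>The nonzero elements of \<open>K\<close> are the roots of unity of order dividing
  \<open>q - 1\<close>. There are at most \<open>q - 1\<close> of them by the degree bound, and at
  least as many because the multiplicative group is cyclic of order \<open>q ^ m - 1\<close>, a
  multiple of \<open>q - 1\<close>.\<close>

lemma card_K: "card K = q"
proof -
  let ?U = "{x \<in> carrier R. x [^] (q - 1) = \<one>}"
  have q: "q = Suc (q - 1)" using q_ge_2 by simp
  have "K = insert \<zero> ?U"
  proof -
    have "x [^] q = x \<longleftrightarrow> x = \<zero> \<or> x [^] (q - 1) = \<one>" if "x \<in> carrier R" for x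
    proof -
      have "x [^] q = x [^] (q - 1) \<otimes> x" by (subst q) simp
      moreover have "x [^] (q - 1) \<otimes> x = \<one> \<otimes> x \<longleftrightarrow> x = \<zero> \<or> x [^] (q - 1) = \<one>"
        using that by (metis m_rcancel nat_pow_closed one_closed r_null)
      ultimately show ?thesis using that by simp
    qed
    then show ?thesis by (auto simp: K_def)
  qed
  moreover have "\<zero> \<notin> ?U" using q_ge_2 nat_pow_zero[of "q - 1"] by auto
  moreover have "card ?U = q - 1"
  proof (rule antisym)
    show "card ?U \<le> q - 1" using q_ge_2 finite_carrier by (intro num_roots_le_deg) auto
    interpret G: group "Multiplicative_Group.mult_of R" rewrites
      "([^]\<^bsub>Multiplicative_Group.mult_of R\<^esub>) = (([^]) :: _ \<Rightarrow> nat \<Rightarrow> _)"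
      and "\<one>\<^bsub>Multiplicative_Group.mult_of R\<^esub> = \<one>"
      by (rule field_mult_group) (simp_all add: Multiplicative_Group.nat_pow_mult_of)
    have "q ^ m - 1 > 0" using q_ge_2 m_pos one_less_power[of q m] by simp
    obtain g where g: "g \<in> carrier (Multiplicative_Group.mult_of R)"
      "carrier (Multiplicative_Group.mult_of R) = {g [^] i | i::nat. i \<in> UNIV}"
      using finite_field_mult_group_has_gen[OF finite_carrier] by auto
    \<comment> \<open>The cofactor \<open>M\<close> serves as exponent step: the elements
      \<open>g [^] (M * j)\<close> with \<open>j < q - 1\<close> will be distinct roots of
      unity.\<close>
    obtain M where M: "q ^ m - 1 = (q - 1) * M"
    proof -
      have "\<exists>M. q ^ n = (q - 1) * M + 1" for n
      proof (induction n)
        case (Suc n)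
        then obtain M where "q ^ n = (q - 1) * M + 1" by blast
        moreover obtain c where "q = Suc c" using q by blast
        ultimately have "q ^ Suc n = (q - 1) * (q * M + 1) + 1" by (simp add: algebra_simps)
        then show ?case by blast
      qed auto
      then obtain M where "q ^ m = (q - 1) * M + 1" by blast
      then show ?thesis using that[of M] by simp
    qed
    have finite_G: "finite (carrier (Multiplicative_Group.mult_of R))"
      using finite_carrier by (rule finite_mult_of)
    have order_G: "order (Multiplicative_Group.mult_of R) = q ^ m - 1"
      using order_mult_of[OF finite_carrier] order_R by simp
    \<comment> \<open>The powers of \<open>g\<close> with exponent below its order exhaust the
      group, which bounds this order from below by \<open>(q - 1) * M\<close>.\<close>
    have "carrier (Multiplicative_Group.mult_of R) = (\<lambda>i. g [^] i) ` {0..G.ord g - 1}"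
      using G.ord_elems[OF finite_G g(1)] g(2) by auto
    then have "q ^ m - 1 \<le> card {0..G.ord g - 1}"
      using order_G card_image_le[of "{0..G.ord g - 1}" "\<lambda>i. g [^] i"] by (simp add: order_def)
    then have ord: "(q - 1) * M \<le> G.ord g"
      using G.ord_ge_1[OF finite_G g(1)] M by simp
    have "inj_on (\<lambda>j. g [^] (M * j)) {..<q - 1}"
    proof (rule inj_onI)
      fix i j assume ij: "i \<in> {..<q - 1}" "j \<in> {..<q - 1}" "g [^] (M * i) = g [^] (M * j)"
      have "M > 0" using M \<open>q ^ m - 1 > 0\<close> by (metis gr0I mult_0_right)
      then have "M * i < (q - 1) * M" "M * j < (q - 1) * M" using ij by auto
      then have "M * i \<in> {0..G.ord g - 1}" "M * j \<in> {0..G.ord g - 1}"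
        using ord unfolding atLeastAtMost_iff by linarith+
      then have "M * i = M * j" by (rule inj_onD[OF G.ord_inj[OF g(1)] ij(3)])
      then show "i = j" using \<open>M > 0\<close> by simp
    qed
    moreover have "(\<lambda>j. g [^] (M * j)) ` {..<q - 1} \<subseteq> ?U"
    proof -
      have "g [^] ((q - 1) * M) = \<one>" using G.pow_order_eq_1[OF g(1)] order_G M by simp
      moreover have "(g [^] (M * j)) [^] (q - 1) = (g [^] ((q - 1) * M)) [^] j" for j
        using g(1) by (simp add: nat_pow_pow ac_simps)
      ultimately show ?thesis using g(1) by auto
    qed
    ultimately show "q - 1 \<le> card ?U"
      using finite_carrier card_inj_on_le[of "\<lambda>j. g [^] (M * j)" "{..<q - 1}" ?U] by simp
  qed
  ultimately show ?thesis using q_ge_2 finite_carrier by simp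
qed

text \<open>Every subfield with \<open>q\<close> elements consists of fixed points of the Frobenius
  map, and equal cardinality then forces it to be \<open>K\<close>; so the definite description
  denotes.\<close>

lemma subfield_of_card_q: "subfield_of_card R q = K"
proof -
  have "L = K" if "subfield L R" "card L = q" for L
  proof (rule card_subset_eq)
    show "finite K" using finite_carrier by (simp add: K_def)
    show "L \<subseteq> K" using pow_card_subfield[OF that(1)] that(2) subfieldE(3)[OF that(1)] by (auto simp: K_def)
  qed (simp add: that card_K)
  then show ?thesis unfolding subfield_of_card_def
    using subfield_K card_K by (intro the_equality conjI) blast+
qed

lemma subfield_of_card_order: "subfield_of_card R (q ^ m) = carrier R"
  unfolding subfield_of_card_def
  using carrier_is_subfield order_R finite_carrier
  by (intro the_equality card_subset_eq) (auto simp: order_def dest: subfieldE(3))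

end

section \<open>Polynomial representation of maps on a finite field\<close>

text \<open>A nonzero difference would vanish on the whole field and so have \<open>order R\<close>
  roots, more than its degree allows.\<close>

lemma (in field) poly_eq_if_eval_eq:
  assumes fin: "finite (carrier R)"
    and p: "p \<in> carrier (poly_ring R)" "length p \<le> order R"
    and q: "q \<in> carrier (poly_ring R)" "length q \<le> order R"
    and eq: "\<And>x. x \<in> carrier R \<Longrightarrow> eval p x = eval q x"
  shows "p = q"
proof -
  interpret UP: domain "poly_ring R" using univ_poly_is_domain[OF carrier_is_subring] .
  let ?d = "p \<ominus>\<^bsub>poly_ring R\<^esub> q"
  have d: "?d \<in> carrier (poly_ring R)" using p q by simp
  have eval_d: "eval ?d x = \<zero>" if x: "x \<in> carrier R" for x
  proof -
    interpret E: ring_hom_cring "poly_ring R" R "\<lambda>p. eval p x"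
      using eval_cring_hom[OF carrier_is_subring x] .
    show ?thesis using p q x eq E.hom_closed by (simp add: a_minus_def r_neg)
  qed
  have "?d = []"
  proof (rule ccontr)
    assume nz: "?d \<noteq> []"
    \<comment> \<open>\<open>roots\<close> is a multiset, so the field is compared with it as a
      multiset in which each element occurs once.\<close>
    have "mset_set (carrier R) \<subseteq># roots ?d"
    proof (rule mset_subset_eqI)
      fix x
      show "count (mset_set (carrier R)) x \<le> count (roots ?d) x"
      proof (cases "x \<in> carrier R")
        case True
        then have "x \<in># roots ?d"
          using nz eval_d by (simp add: roots_mem_iff_is_root[OF d] is_root_def)
        then show ?thesis using True fin by (simp add: Suc_leI)
      qed simp
    qed
    then have "order R \<le> size (roots ?d)"
      using size_mset_mono by (fastforce simp: order_def)
    also have "\<dots> \<le> length ?d - 1" using size_roots_le_degree[OF d] .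
    also have "\<dots> < length ?d" using nz by simp
    also have "\<dots> \<le> order R"
    proof -
      have "?d = poly_add p (\<ominus>\<^bsub>poly_ring R\<^esub> q)"
        by (simp add: a_minus_def univ_poly_add)
      then have "length ?d \<le> max (length p) (length (\<ominus>\<^bsub>poly_ring R\<^esub> q))"
        using poly_add_length_le by metis
      then show ?thesis
        using p q univ_poly_a_inv_length[OF carrier_is_subring q(1)] by simp
    qed
    finally show False by simp
  qed
  then have "?d = \<zero>\<^bsub>poly_ring R\<^esub>" by (simp add: univ_poly_zero)
  then show ?thesis using p q UP.r_right_minus_eq by blast
qed

text \<open>Existence comes from counting instead of an explicit formula: with n =
  \<open>order R\<close>, evaluation is injective from the coefficient lists of length n to the maps
  of the carrier into itself, and both sets have n^n elements.\<close>

lemma (in field) polynomial_interpolation: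
  assumes fin: "finite (carrier R)" and f: "f \<in> carrier R \<rightarrow> carrier R"
  shows "\<exists>!P. P \<in> carrier (poly_ring R) \<and> length P \<le> order R \<and> (\<forall>x\<in>carrier R. eval P x = f x)"
proof (rule ex_ex1I)
  \<comment> \<open>Leading zeros are allowed, so that all lists have one length and are easy to
    count; \<open>normalize\<close> strips them later.\<close>
  let ?L = "{xs. set xs \<subseteq> carrier R \<and> length xs = order R}"
  let ?E = "\<lambda>xs. restrict (eval xs) (carrier R)"
  let ?F = "carrier R \<rightarrow>\<^sub>E carrier R"
  have normalize: "normalize xs \<in> carrier (poly_ring R) \<and> length (normalize xs) \<le> order R"
    if "xs \<in> ?L" for xs
    using that normalize_gives_polynomial[of xs "carrier R"] normalize_length_le[of xs]
    by (auto simp: univ_poly_carrier)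
  have "inj_on ?E ?L"
  proof (rule inj_onI)
    fix xs ys assume xy: "xs \<in> ?L" "ys \<in> ?L" "?E xs = ?E ys"
    have "eval xs x = eval ys x" if "x \<in> carrier R" for x
      using xy(3) that by (metis restrict_apply')
    then have "normalize xs = normalize ys"
      using xy normalize by (intro poly_eq_if_eval_eq fin) (auto simp: eval_normalize)
    \<comment> \<open>A list of known length is recovered from its normalized form by padding with
      zeros.\<close>
    then show "xs = ys"
      using xy(1,2) normalize_trick[of xs] normalize_trick[of ys] by simp
  qed
  then have "card (?E ` ?L) = card ?F"
    using fin by (simp add: card_image card_lists_length_eq card_PiE order_def)
  moreover have "?E ` ?L \<subseteq> ?F" using eval_in_carrier by auto
  moreover have "finite ?F" using fin by (intro finite_PiE) auto
  ultimately have "?E ` ?L = ?F" by (intro card_subset_eq)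
  moreover have "restrict f (carrier R) \<in> ?F" using f by auto
  ultimately obtain xs where xs: "xs \<in> ?L" "restrict f (carrier R) = ?E xs" by blast
  have "eval (normalize xs) x = f x" if "x \<in> carrier R" for x
    using xs that by (metis (mono_tags, lifting) eval_normalize mem_Collect_eq restrict_apply')
  then show "\<exists>P. P \<in> carrier (poly_ring R) \<and> length P \<le> order R \<and> (\<forall>x\<in>carrier R. eval P x = f x)"
    using normalize[OF xs(1)] by blast
next
  fix P Q
  assume "P \<in> carrier (poly_ring R) \<and> length P \<le> order R \<and> (\<forall>x\<in>carrier R. eval P x = f x)"
    and "Q \<in> carrier (poly_ring R) \<and> length Q \<le> order R \<and> (\<forall>x\<in>carrier R. eval Q x = f x)"
  then show "P = Q" by (intro poly_eq_if_eval_eq fin) auto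
qed

section \<open>Coefficients in the base field and commutation with Frobenius\<close>

context finite_field_extension
begin

lemma frobenius_power_m:
  assumes "x \<in> carrier R"
  shows "x [^] (q ^ m) = x"
  using pow_card_subfield[OF carrier_is_subfield assms] order_R by (simp add: order_def)

lemma frobenius_funpow:
  assumes "x \<in> carrier R"
  shows "((\<lambda>x. x [^] q) ^^ i) x = x [^] (q ^ i)"
  using assms by (induction i) (auto simp: nat_pow_pow mult.commute)

lemma frobenius_surj:
  assumes "y \<in> carrier R"
  obtains x where "x \<in> carrier R" "y = x [^] q"
proof
  show "y = (y [^] (q ^ (m - 1))) [^] q"
    using assms frobenius_power_m[OF assms] m_pos by (simp add: nat_pow_pow power_eq_if mult.commute)
qed (use assms in simp)

lemma coefficients_in_subfield_iff:
  assumes f: "f \<in> carrier R \<rightarrow> carrier R"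
  shows "set (poly_representation R f) \<subseteq> K \<longleftrightarrow> (\<forall>x\<in>carrier R. f (x [^] q) = f x [^] q)"
proof -
  interpret h: ring_hom_ring R R "\<lambda>x. x [^] q" by (rule frobenius_ring_hom_ring)
  let ?P = "poly_representation R f"
  note interpolation = polynomial_interpolation[OF finite_carrier f]
  have P: "?P \<in> carrier (poly_ring R)" "length ?P \<le> order R" "\<And>x. x \<in> carrier R \<Longrightarrow> eval ?P x = f x"
    using theI'[OF interpolation] unfolding poly_representation_def by auto
  have set_P: "set ?P \<subseteq> carrier R"
    using P(1) polynomial_incl univ_poly_carrier by blast
  \<comment> \<open>A ring homomorphism commutes with evaluation once it is also applied to the
    coefficients.\<close>
  have eval_map: "eval (map (\<lambda>x. x [^] q) ?P) (x [^] q) = f x [^] q" if "x \<in> carrier R" for x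
    using h.eval_hom'[OF that set_P] P(3)[OF that] by simp
  have fixed_iff: "set ?P \<subseteq> K \<longleftrightarrow> map (\<lambda>x. x [^] q) ?P = ?P"
    using set_P map_eq_conv[of "\<lambda>x. x [^] q" ?P "\<lambda>x. x"] by (auto simp: K_def)
  show ?thesis
  proof
    assume "set ?P \<subseteq> K"
    then show "\<forall>x\<in>carrier R. f (x [^] q) = f x [^] q"
      using eval_map P(3) fixed_iff by (metis nat_pow_closed)
  next
    assume comm: "\<forall>x\<in>carrier R. f (x [^] q) = f x [^] q"
    have "map (\<lambda>x. x [^] q) ?P = ?P"
    proof (rule poly_eq_if_eval_eq[OF finite_carrier _ _ P(1,2)])
      have "polynomial (carrier R) ?P" using P(1) by (simp add: univ_poly_carrier)
      \<comment> \<open>A nonzero leading coefficient has a nonzero \<open>q\<close>-th power, so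
        the new list is still normalized.\<close>
      then have "polynomial (carrier R) (map (\<lambda>x. x [^] q) ?P)"
        using q_ge_2 by (cases ?P) (auto simp: polynomial_def dest: nat_pow_eq_zero_imp)
      then show "map (\<lambda>x. x [^] q) ?P \<in> carrier (poly_ring R)" by (simp add: univ_poly_carrier)
      show "length (map (\<lambda>x. x [^] q) ?P) \<le> order R" using P(2) by simp
      \<comment> \<open>Every \<open>y\<close> is a \<open>q\<close>-th power, so it suffices to
        compare the two polynomials at points \<open>x [^] q\<close>, where \<open>eval_map\<close>
        applies.\<close>
      fix y assume "y \<in> carrier R"
      then show "eval (map (\<lambda>x. x [^] q) ?P) y = eval ?P y"
        by (rule frobenius_surj) (use eval_map comm P(3) in auto)
    qed
    then show "set ?P \<subseteq> K" using fixed_iff by blast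
  qed
qed

end

section \<open>Orbits of prime length and equivariant maps\<close>

lemma funpow_mult_fixpoint:
  assumes "(f ^^ d) a = a"
  shows "(f ^^ (d * n)) a = a"
  using assms by (induction n) (simp_all add: funpow_add)

text \<open>If two of these iterates agree, their index difference is a period of \<open>a\<close>
  coprime to \<open>p\<close>; together with the period \<open>p\<close> it makes \<open>a\<close> a
  fixed point.\<close>

lemma inj_on_funpow_prime_period:
  assumes p: "Factorial_Ring.prime p" and per: "(f ^^ p) a = a" and nonfix: "f a \<noteq> a"
  shows "inj_on (\<lambda>i. (f ^^ i) a) {..<p}"
proof -
  have neq: "(f ^^ i) a \<noteq> (f ^^ j) a" if ij: "i < j" "j < p" for i j
  proof
    assume eq: "(f ^^ i) a = (f ^^ j) a"
    \<comment> \<open>Going once around the period replaces cancellation, since \<open>f\<close> is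
      not assumed injective.\<close>
    have "(f ^^ (j - i)) a = (f ^^ (j - i)) ((f ^^ p) a)" using per by simp
    also have "\<dots> = (f ^^ (p - i)) ((f ^^ j) a)"
      using ij by (simp add: add.commute flip: funpow_add comp_apply[of "f ^^ _" "f ^^ _"])
    also have "\<dots> = (f ^^ (p - i)) ((f ^^ i) a)" using eq by simp
    also have "\<dots> = a" using ij per by (simp flip: funpow_add comp_apply[of "f ^^ _" "f ^^ _"])
    finally have fix_d: "(f ^^ (j - i)) a = a" .
    have "coprime p (j - i)"
      using p ij by (intro prime_imp_coprime) (auto dest: dvd_imp_le)
    \<comment> \<open>By Bezout a multiple of one period exceeds a multiple of the other by exactly
      1.\<close>
    then obtain x y where "(j - i) * x = p * y + 1"
      using bezout_nat[of "j - i" p] ij by (auto simp: coprime_iff_gcd_eq_1 gcd.commute)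
    then have "a = (f ^^ Suc (p * y)) a"
      using funpow_mult_fixpoint[OF fix_d, of x] by simp
    then show False using funpow_mult_fixpoint[OF per, of y] nonfix by simp
  qed
  show ?thesis
    by (rule inj_onI) (metis neq lessThan_iff linorder_neqE_nat)
qed

text \<open>\<open>B\<close> collects one point of each orbit, and each element of \<open>A\<close>
  gets unique coordinates: its representative and its position in the orbit. The induction removes
  one orbit at a time.\<close>

lemma orbit_transversal:
  assumes "finite A" and p: "Factorial_Ring.prime p" and "f ` A \<subseteq> A"
    and "\<And>x. x \<in> A \<Longrightarrow> (f ^^ p) x = x" and "\<And>x. x \<in> A \<Longrightarrow> f x \<noteq> x"
  shows "\<exists>B\<subseteq>A. bij_betw (\<lambda>(b, i). (f ^^ i) b) (B \<times> {..<p}) A"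
  using assms(1,3-)
proof (induction A rule: finite_psubset_induct)
  case (psubset A)
  show ?case
  proof (cases "A = {}")
    case True
    then show ?thesis by (auto simp: bij_betw_def)
  next
    case False
    then obtain a where a: "a \<in> A" by blast
    define Orb where "Orb = (\<lambda>i. (f ^^ i) a) ` {..<p}"
    have p0: "0 < p" using p prime_gt_0_nat by blast
    have step: "(f ^^ i) x \<in> A" if "x \<in> A" for x i
      using that psubset.prems(1) by (induction i) auto
    have f_Orb: "f y \<in> Orb" if y: "y \<in> Orb" for y
    proof -
      obtain i where i: "i < p" "y = (f ^^ i) a" using y unfolding Orb_def by blast
      show ?thesis
      proof (cases "Suc i = p")
        case True
        then have "f y = (f ^^ 0) a" using i psubset.prems(2)[OF a] by auto
        then show ?thesis using p0 unfolding Orb_def by blast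
      next
        case False
        then have "f y = (f ^^ Suc i) a" "Suc i < p" using i by auto
        then show ?thesis unfolding Orb_def by blast
      qed
    qed
    have pow_Orb: "(f ^^ i) y \<in> Orb" if "y \<in> Orb" for y i
      using that f_Orb by (induction i) auto
    have "a \<in> Orb" unfolding Orb_def using p0 by (auto intro!: image_eqI[of _ _ 0])
    then have "A - Orb \<subset> A" using a by blast
    \<comment> \<open>No point outside can enter the orbit, because \<open>f ^^ (p - 1)\<close>
      undoes \<open>f\<close> and preserves the orbit.\<close>
    moreover have "f ` (A - Orb) \<subseteq> A - Orb"
    proof -
      have "x \<in> Orb" if "x \<in> A" "f x \<in> Orb" for x
      proof -
        have "(f ^^ (p - 1)) (f x) = (f ^^ Suc (p - 1)) x" by (simp only: funpow_Suc_right comp_apply)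
        then have "(f ^^ (p - 1)) (f x) = x"
          using psubset.prems(2)[OF that(1)] p0 by simp
        then show ?thesis using pow_Orb[OF that(2), of "p - 1"] by simp
      qed
      then show ?thesis using psubset.prems(1) by blast
    qed
    ultimately obtain B where B: "B \<subseteq> A - Orb"
      "bij_betw (\<lambda>(b, i). (f ^^ i) b) (B \<times> {..<p}) (A - Orb)"
      using psubset.IH[of "A - Orb"] psubset.prems by auto
    have "inj_on (\<lambda>i. (f ^^ i) a) {..<p}"
      by (intro inj_on_funpow_prime_period p psubset.prems a)
    then have "bij_betw (\<lambda>(b, i). (f ^^ i) b) ({a} \<times> {..<p}) Orb"
      by (auto simp: bij_betw_def Orb_def inj_on_def image_iff)
    then have "bij_betw (\<lambda>(b, i). (f ^^ i) b) ({a} \<times> {..<p} \<union> B \<times> {..<p}) (Orb \<union> (A - Orb))"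
      using B(2) by (rule bij_betw_combine) auto
    moreover have "Orb \<subseteq> A" using step a unfolding Orb_def by blast
    ultimately have "bij_betw (\<lambda>(b, i). (f ^^ i) b) (insert a B \<times> {..<p}) A"
      by (simp add: Un_absorb1 flip: Sigma_Un_distrib1)
    then show ?thesis using a B(1) by (intro exI[of _ "insert a B"]) auto
  qed
qed

text \<open>Restriction to a transversal \<open>B\<close> is a bijection onto all maps from
  \<open>B\<close> to \<open>C\<close>: the values along each orbit are forced by the value at its
  representative, which is arbitrary.\<close>

lemma card_equivariant_maps:
  assumes fin: "finite A" "finite C" and p: "Factorial_Ring.prime p"
    and f: "f ` A \<subseteq> A" "\<And>x. x \<in> A \<Longrightarrow> (f ^^ p) x = x" "\<And>x. x \<in> A \<Longrightarrow> f x \<noteq> x"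
    and g: "g ` C \<subseteq> C" "\<And>y. y \<in> C \<Longrightarrow> (g ^^ p) y = y"
  shows "card {h \<in> A \<rightarrow>\<^sub>E C. \<forall>x\<in>A. h (f x) = g (h x)} = card C ^ (card A div p)"
proof -
  obtain B where B: "B \<subseteq> A" "bij_betw (\<lambda>(b, i). (f ^^ i) b) (B \<times> {..<p}) A"
    using orbit_transversal[OF fin(1) p f] by blast
  have p0: "0 < p" using p prime_gt_0_nat by blast
  have "card A = card B * p" using bij_betw_same_card[OF B(2)] by (simp add: card_cartesian_product)
  then have card_B: "card A div p = card B" using p0 by simp
  have finB: "finite B" using B(1) fin finite_subset by blast
  let ?Eq = "{h \<in> A \<rightarrow>\<^sub>E C. \<forall>x\<in>A. h (f x) = g (h x)}"
  have gC: "(g ^^ i) y \<in> C" if "y \<in> C" for y i using that g(1) by (induction i) auto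
  have fA: "(f ^^ i) x \<in> A" if "x \<in> A" for x i using that f(1) by (induction i) auto
  have eq_pow: "h ((f ^^ i) x) = (g ^^ i) (h x)" if "h \<in> ?Eq" "x \<in> A" for h x i
    using that fA by (induction i) auto
  have "bij_betw (\<lambda>h. restrict h B) ?Eq (B \<rightarrow>\<^sub>E C)"
    unfolding bij_betw_def
  proof
    show "inj_on (\<lambda>h. restrict h B) ?Eq"
    proof (rule inj_onI)
      fix h k assume hk: "h \<in> ?Eq" "k \<in> ?Eq" "restrict h B = restrict k B"
      have "h x = k x" if x: "x \<in> A" for x
      proof -
        obtain b i where b: "b \<in> B" "x = (f ^^ i) b"
          using x B(2) by (auto simp: bij_betw_def)
        then have "h b = k b" using hk(3) by (metis restrict_apply')
        then show ?thesis
          using eq_pow[OF hk(1), of b i] eq_pow[OF hk(2), of b i] b B(1) by auto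
      qed
      then show "h = k" using hk(1,2) by (intro PiE_ext[of h A "\<lambda>_. C"]) auto
    qed
    show "(\<lambda>h. restrict h B) ` ?Eq = B \<rightarrow>\<^sub>E C"
    proof
      show "(\<lambda>h. restrict h B) ` ?Eq \<subseteq> B \<rightarrow>\<^sub>E C" using B(1) by auto
      show "B \<rightarrow>\<^sub>E C \<subseteq> (\<lambda>h. restrict h B) ` ?Eq"
      proof
        fix k assume k: "k \<in> B \<rightarrow>\<^sub>E C"
        \<comment> \<open>\<open>d\<close> returns the coordinates of a point, and \<open>h\<close>
          spreads \<open>k\<close> along each orbit by iterating \<open>g\<close>.\<close>
        define d where "d = inv_into (B \<times> {..<p}) (\<lambda>(b, i). (f ^^ i) b)"
        have d: "d ((f ^^ i) b) = (b, i)" if "b \<in> B" "i < p" for b i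
          using inv_into_f_f[OF bij_betw_imp_inj_on[OF B(2)], of "(b, i)"] that by (simp add: d_def)
        define h where "h = (\<lambda>x\<in>A. (g ^^ snd (d x)) (k (fst (d x))))"
        have h: "h ((f ^^ i) b) = (g ^^ i) (k b)" if "b \<in> B" "i < p" for b i
          using that d fA B(1) by (auto simp: h_def)
        have dec: "\<exists>b i. b \<in> B \<and> i < p \<and> x = (f ^^ i) b" if "x \<in> A" for x
          using that B(2) by (force simp: bij_betw_def)
        have "h x \<in> C" if "x \<in> A" for x
          using dec[OF that] h PiE_mem[OF k] gC by auto
        then have "h \<in> A \<rightarrow>\<^sub>E C" by (auto simp: h_def)
        moreover have "h (f x) = g (h x)" if x: "x \<in> A" for x
        proof -
          obtain b i where b: "b \<in> B" "i < p" "x = (f ^^ i) b" using dec[OF x] by blast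
          show ?thesis
          proof (cases "Suc i = p")
            case True
            \<comment> \<open>At the last position the orbit closes up at \<open>b\<close>;
              equivariance there rests on \<open>g ^^ p\<close> being the identity on
              \<open>C\<close>.\<close>
            have "f x = (f ^^ p) b" using b True by auto
            then have "f x = (f ^^ 0) b" using f(2) b(1) B(1) by auto
            then have "h (f x) = k b" using h[OF b(1), of 0] p0 by simp
            moreover have "g (h x) = (g ^^ p) (k b)" using b h True by auto
            ultimately show ?thesis using g(2)[OF PiE_mem[OF k b(1)]] by simp
          next
            case False
            then have "h ((f ^^ Suc i) b) = (g ^^ Suc i) (k b)" using b by (intro h) auto
            then show ?thesis using h b by simp
          qed
        qed
        moreover have "restrict h B = k"
          using k h[of _ 0] p0 by (intro PiE_ext[of "restrict h B" B "\<lambda>_. UNIV" k]) auto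
        ultimately show "k \<in> (\<lambda>h. restrict h B) ` ?Eq" by force
      qed
    qed
  qed
  then have "card ?Eq = card (B \<rightarrow>\<^sub>E C)" by (rule bij_betw_same_card)
  then show ?thesis using finB card_B by (simp add: card_PiE)
qed

section \<open>The number of subfield preserving maps in prime degree\<close>

locale prime_degree_extension = finite_field_extension R q p for R (structure) and q p :: nat +
  assumes prime_p: "Factorial_Ring.prime p"
begin

text \<open>The divisors of a prime are 1 and \<open>p\<close>, and only \<open>d = p\<close>,
  \<open>s = 1\<close> gives a nonempty difference of subfields.\<close>

lemma subfield_preserving_iff:
  "subfield_preserving R q p f \<longleftrightarrow> f ` K \<subseteq> K \<and> f ` (carrier R - K) \<subseteq> carrier R - K"
    (is "_ \<longleftrightarrow> ?rhs")
proof
  assume f: "subfield_preserving R q p f"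
  then have "f ` (subfield_of_card R (q ^ p) - subfield_of_card R (q ^ 1))
      \<subseteq> subfield_of_card R (q ^ p) - subfield_of_card R (q ^ 1)"
    unfolding subfield_preserving_def using m_pos by (meson dvd_refl one_dvd zero_less_one)
  then show ?rhs
    using f by (simp add: subfield_preserving_def subfield_of_card_q subfield_of_card_order)
next
  assume f: ?rhs
  have "f ` (subfield_of_card R (q ^ d) - subfield_of_card R (q ^ s))
      \<subseteq> subfield_of_card R (q ^ d) - subfield_of_card R (q ^ s)" if "d dvd p" "s dvd p" for d s
  proof -
    have "d = 1 \<or> d = p" "s = 1 \<or> s = p" using prime_p that by (metis prime_nat_iff)+
    moreover have "K \<subseteq> carrier R" by (auto simp: K_def)
    then have "K - carrier R = {}" by blast
    ultimately show ?thesis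
      using f by (elim disjE) (simp_all only: subfield_of_card_q subfield_of_card_order power_one_right, auto)
  qed
  then show "subfield_preserving R q p f"
    using f by (simp add: subfield_preserving_def subfield_of_card_q)
qed

lemma card_subfield_preserving_maps:
  "card (subfield_preserving_maps R q p) = q ^ q * (q ^ p - q) ^ ((q ^ p - q) div p)"
proof -
  let ?A = "carrier R - K"
  let ?\<phi> = "\<lambda>x. x [^] q"
  let ?Eq = "{h \<in> ?A \<rightarrow>\<^sub>E ?A. \<forall>x\<in>?A. h (?\<phi> x) = ?\<phi> (h x)}"
  have K: "K \<subseteq> carrier R" "finite K" and K_iff: "\<And>x. x \<in> carrier R \<Longrightarrow> x \<in> K \<longleftrightarrow> x [^] q = x"
    using finite_carrier by (auto simp: K_def)
  have card_A: "card ?A = q ^ p - q"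
    using card_Diff_subset[OF K(2,1)] card_K order_R by (simp add: order_def)
  have period: "(?\<phi> ^^ p) x = x" if "x \<in> carrier R" for x
    using that frobenius_funpow frobenius_power_m by simp
  have stable: "?\<phi> x \<in> ?A" if "x \<in> ?A" for x
  proof -
    \<comment> \<open>If \<open>x [^] q\<close> were fixed, all further iterates would stay there;
      as the \<open>p\<close>-th iterate is \<open>x\<close>, the point \<open>x\<close> itself
      would be fixed.\<close>
    have "x [^] q \<notin> K"
    proof
      assume "x [^] q \<in> K"
      then have "(?\<phi> ^^ i) (x [^] q) = x [^] q" for i
        by (induction i) (auto simp: K_def)
      then have "(?\<phi> ^^ p) x = x [^] q"
        using m_pos by (metis Suc_pred comp_apply funpow_Suc_right)
      then show False using that period[of x] K_iff by auto
    qed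
    then show ?thesis using that by auto
  qed
  have coeffs: "set (poly_representation R f) \<subseteq> K \<longleftrightarrow> (\<forall>x\<in>carrier R. f (x [^] q) = f x [^] q)"
    if "f \<in> carrier R \<rightarrow>\<^sub>E carrier R" for f
    using that by (intro coefficients_in_subfield_iff) auto
  have maps_eq: "subfield_preserving_maps R q p =
      {f \<in> carrier R \<rightarrow>\<^sub>E carrier R. f ` K \<subseteq> K \<and> f ` ?A \<subseteq> ?A \<and>
         (\<forall>x\<in>carrier R. f (x [^] q) = f x [^] q)}" (is "_ = ?T")
    unfolding subfield_preserving_maps_def subfield_of_card_q
    by (simp only: subfield_preserving_iff coeffs conj_assoc cong: conj_cong)
  have "card ?T = card ((K \<rightarrow>\<^sub>E K) \<times> ?Eq)"
  proof (rule bij_betw_same_card)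
    show "bij_betw (\<lambda>f. (restrict f K, restrict f ?A)) ?T ((K \<rightarrow>\<^sub>E K) \<times> ?Eq)"
    proof (rule bij_betw_byWitness[where f' = "\<lambda>(g, h). \<lambda>x\<in>carrier R. if x \<in> K then g x else h x"])
      show "\<forall>f\<in>?T. (case (restrict f K, restrict f ?A) of
          (g, h) \<Rightarrow> \<lambda>x\<in>carrier R. if x \<in> K then g x else h x) = f"
        by (auto simp: fun_eq_iff PiE_iff extensional_def)
      show "\<forall>gh\<in>(K \<rightarrow>\<^sub>E K) \<times> ?Eq.
          (\<lambda>f. (restrict f K, restrict f ?A)) (case gh of
            (g, h) \<Rightarrow> \<lambda>x\<in>carrier R. if x \<in> K then g x else h x) = gh"
        using K(1) by (auto simp: fun_eq_iff PiE_iff extensional_def)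
      show "(\<lambda>f. (restrict f K, restrict f ?A)) ` ?T \<subseteq> (K \<rightarrow>\<^sub>E K) \<times> ?Eq"
        using stable by (auto simp: PiE_iff)
      show "(\<lambda>(g, h). \<lambda>x\<in>carrier R. if x \<in> K then g x else h x) ` ((K \<rightarrow>\<^sub>E K) \<times> ?Eq) \<subseteq> ?T"
      proof (intro image_subsetI, clarify)
        fix g h assume g: "g \<in> K \<rightarrow>\<^sub>E K" and h: "h \<in> ?A \<rightarrow>\<^sub>E ?A"
          and eq: "\<forall>x\<in>?A. h (?\<phi> x) = ?\<phi> (h x)"
        let ?f = "\<lambda>x\<in>carrier R. if x \<in> K then g x else h x"
        have gK: "g x \<in> K" if "x \<in> K" for x using g that by auto
        have hA: "h x \<in> ?A" if "x \<in> ?A" for x using h that by auto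
        \<comment> \<open>On \<open>K\<close> both sides equal \<open>g x\<close>, so any
          \<open>g\<close> will do; on the complement this is the equivariance of
          \<open>h\<close>.\<close>
        have "?f (x [^] q) = ?f x [^] q" if x: "x \<in> carrier R" for x
        proof (cases "x \<in> K")
          case True
          then have "x [^] q = x" "g x [^] q = g x" using gK by (auto simp: K_def)
          then show ?thesis using True x by simp
        next
          case False
          then show ?thesis using x stable[of x] eq by auto
        qed
        then show "?f \<in> carrier R \<rightarrow>\<^sub>E carrier R \<and> ?f ` K \<subseteq> K \<and> ?f ` ?A \<subseteq> ?A \<and>
            (\<forall>x\<in>carrier R. ?f (x [^] q) = ?f x [^] q)"
          using gK hA K(1) by (intro conjI) (auto simp: PiE_iff)
      qed
    qed
  qed
  then have "card (subfield_preserving_maps R q p) = card (K \<rightarrow>\<^sub>E K) * card ?Eq"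
    unfolding maps_eq by (simp only: card_cartesian_product)
  moreover have "card (K \<rightarrow>\<^sub>E K) = q ^ q" using K(2) card_K by (simp add: card_PiE)
  moreover have "card ?Eq = card ?A ^ (card ?A div p)"
    using stable period K_iff finite_carrier
    by (intro card_equivariant_maps prime_p) auto
  ultimately show ?thesis by (simp only: card_A)
qed

end

section \<open>Bounds for the ratio and the two limits\<close>

text \<open>Fermat's little theorem; it makes the division by \<open>p\<close> in the exponent
  exact.\<close>

lemma prime_dvd_power_diff_self:
  fixes q p :: nat
  assumes p: "Factorial_Ring.prime p"
  shows "p dvd q ^ p - q"
proof (cases "p dvd q")
  case True
  then show ?thesis using prime_gt_0_nat[OF p] by (intro dvd_diff_nat) (auto intro: dvd_trans)
next
  case False
  have p0: "0 < p" using p by (rule prime_gt_0_nat)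
  have "0 < q" using False by (metis dvd_0_right gr0I)
  then have "q \<le> q ^ p" using p0 by (intro self_le_power) auto
  moreover have "[q * q ^ (p - 1) = q * 1] (mod p)"
    using p False by (intro cong_scalar_left fermat_theorem)
  then have "[q ^ p = q] (mod p)" using p0 by (simp add: power_eq_if)
  ultimately show ?thesis by (simp add: cong_altdef_nat)
qed

text \<open>Since \<open>q ^ p = q + p * k\<close>, the denominator is
  \<open>q ^ q * (q ^ p) ^ k\<close>, and \<open>q ^ q\<close> cancels.\<close>

lemma equivariant_map_ratio_eq:
  fixes q p :: nat
  assumes q: "0 < q" and p: "Factorial_Ring.prime p"
  shows "real (q ^ q * (q ^ p - q) ^ ((q ^ p - q) div p)) / real (q ^ (q ^ p))
    = (1 - real q / real (q ^ p)) ^ ((q ^ p - q) div p)"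
proof -
  define k where "k = (q ^ p - q) div p"
  have qN: "q \<le> q ^ p" using q prime_gt_0_nat[OF p] by (intro self_le_power) auto
  have "q ^ p = q + p * k" using prime_dvd_power_diff_self[OF p, of q] qN by (simp add: k_def)
  then have "q ^ (q ^ p) = q ^ q * (q ^ p) ^ k" by (metis power_add power_mult)
  then have "real (q ^ q * (q ^ p - q) ^ k) / real (q ^ (q ^ p))
      = real ((q ^ p - q) ^ k) / real ((q ^ p) ^ k)"
    using q by simp
  also have "\<dots> = (real (q ^ p - q) / real (q ^ p)) ^ k"
    by (simp only: of_nat_power power_divide)
  also have "real (q ^ p - q) / real (q ^ p) = 1 - real q / real (q ^ p)"
    using qN q by (simp add: of_nat_diff diff_divide_distrib)
  finally show ?thesis unfolding k_def .
qed

lemma equivariant_map_ratio_bounds: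
  fixes q p :: nat
  assumes q: "2 \<le> q" and p: "Factorial_Ring.prime p"
  defines "r \<equiv> real (q ^ q * (q ^ p - q) ^ ((q ^ p - q) div p)) / real (q ^ (q ^ p))"
  shows "1 - real q / real p \<le> r" "r \<le> 1" "r \<le> exp (- (real q - 1) / real p)" "0 \<le> r"
proof -
  define N where "N = q ^ p"
  define k where "k = (N - q) div p"
  have p2: "2 \<le> p" using p by (rule prime_ge_2_nat)
  have qN: "q ^ 2 \<le> N" unfolding N_def using q p2 by (intro power_increasing) auto
  then have "q * 2 \<le> N" using q by (metis mult_le_mono2 order_trans power2_eq_square)
  then have qN1: "q \<le> N" "0 < N" using q by auto
  have r: "r = (1 - real q / real N) ^ k"
    unfolding r_def N_def k_def using q by (intro equivariant_map_ratio_eq p) simp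
  have pk: "real p * real k = real N - real q"
    using prime_dvd_power_diff_self[OF p, of q] qN1 unfolding k_def N_def
    by (metis dvd_mult_div_cancel of_nat_diff of_nat_mult)
  have frac: "0 \<le> real q / real N" "real q / real N \<le> 1" using qN1 by auto
  show "0 \<le> r" "r \<le> 1" unfolding r using frac by (auto intro!: power_le_one)
  have "real k / real N \<le> 1 / real p"
    using pk p2 qN1 by (simp add: field_simps)
  then have "real q * (real k / real N) \<le> real q * (1 / real p)"
    by (rule mult_left_mono) simp
  moreover have "1 + real k * (- (real q / real N)) \<le> (1 + - (real q / real N)) ^ k"
    by (rule Bernoulli_inequality) (use frac in simp)
  ultimately show "1 - real q / real p \<le> r" unfolding r by (simp add: mult.commute)
  have "r \<le> exp (- (real q / real N)) ^ k"
    unfolding r using frac exp_ge_add_one_self[of "- (real q / real N)"] by (intro power_mono) auto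
  also have "\<dots> = exp (- (real k * (real q / real N)))"
    by (simp add: exp_of_nat_mult[symmetric])
  also have "\<dots> \<le> exp (- (real q - 1) / real p)"
  proof -
    \<comment> \<open>The exponent \<open>k * q / N\<close> equals
      \<open>q * (N - q) / (p * N)\<close>, and this is at least \<open>(q - 1) / p\<close>
      precisely when \<open>q ^ 2 \<le> N\<close>.\<close>
    have "real (q ^ 2) \<le> real N" using qN by (rule of_nat_mono)
    then have "(real q - 1) * real N \<le> real q * (real N - real q)"
      by (simp add: algebra_simps power2_eq_square)
    also have "\<dots> = real p * (real k * real q)" using pk by (simp add: ac_simps)
    finally show ?thesis using p2 qN1 by (simp add: field_simps)
  qed
  finally show "r \<le> exp (- (real q - 1) / real p)" .
qed

text \<open>The family \<open>GF\<close> stands for an arbitrary choice of fields of prime power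
  order. The infimum with a principal filter restricts the passage to infinity to primes or prime
  powers.\<close>

theorem corollary21:
  fixes GF :: "nat \<Rightarrow> ('a, 'b) ring_scheme"
  assumes "\<And>n. primepow n \<Longrightarrow> field (GF n)"
    and "\<And>n. primepow n \<Longrightarrow> order (GF n) = n"
  shows "(\<forall>q. primepow q \<longrightarrow>
           ((\<lambda>p. real (card (subfield_preserving_maps (GF (q ^ p)) q p)) / real (q ^ (q ^ p)))
              \<longlongrightarrow> 1) (inf at_top (principal {p. Factorial_Ring.prime p}))) \<and>
         (\<forall>p. Factorial_Ring.prime p \<longrightarrow>
           ((\<lambda>q. real (card (subfield_preserving_maps (GF (q ^ p)) q p)) / real (q ^ (q ^ p)))
              \<longlongrightarrow> 0) (inf at_top (principal {q. primepow q})))"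
proof -
  let ?r = "\<lambda>q p. real (card (subfield_preserving_maps (GF (q ^ p)) q p)) / real (q ^ (q ^ p))"
  have bounds: "1 - real q / real p \<le> ?r q p" "?r q p \<le> 1"
    "?r q p \<le> exp (- (real q - 1) / real p)" "0 \<le> ?r q p"
    if q: "primepow q" and p: "Factorial_Ring.prime p" for q p
  proof -
    have "primepow (q ^ p)" using q p primepow_gt_Suc_0[OF q] by (simp add: primepow_power_iff_nat prime_gt_0_nat)
    then have "prime_degree_extension (GF (q ^ p)) q p"
      using assms q p by (simp add: prime_degree_extension_def finite_field_extension_def
        finite_field_extension_axioms_def prime_degree_extension_axioms_def prime_gt_0_nat)
    then have card: "card (subfield_preserving_maps (GF (q ^ p)) q p)
        = q ^ q * (q ^ p - q) ^ ((q ^ p - q) div p)"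
      by (rule prime_degree_extension.card_subfield_preserving_maps)
    have "2 \<le> q" using q primepow_gt_Suc_0[of q] by simp
    from equivariant_map_ratio_bounds[OF this p] show "1 - real q / real p \<le> ?r q p" "?r q p \<le> 1"
      "?r q p \<le> exp (- (real q - 1) / real p)" "0 \<le> ?r q p"
      unfolding card by blast+
  qed
  show ?thesis
  proof (intro conjI allI impI)
    fix q :: nat assume q: "primepow q"
    let ?F = "inf at_top (principal {p::nat. Factorial_Ring.prime p})"
    have "((\<lambda>p. 1 - real q / real p) \<longlongrightarrow> 1) at_top" by real_asymp
    \<comment> \<open>Restriction to the primes gives a finer filter, so a limit along all natural
      numbers carries over.\<close>
    then have lim: "((\<lambda>p. 1 - real q / real p) \<longlongrightarrow> 1) ?F" by (rule tendsto_mono[rotated]) simp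
    show "(?r q \<longlongrightarrow> 1) ?F"
      by (rule tendsto_sandwich[OF _ _ lim tendsto_const])
        (use bounds(1,2)[OF q] in \<open>auto simp: eventually_inf_principal intro!: always_eventually\<close>)
  next
    fix p :: nat assume p: "Factorial_Ring.prime p"
    let ?F = "inf at_top (principal {q::nat. primepow q})"
    have "((\<lambda>q. exp (- (real q - 1) / real p)) \<longlongrightarrow> 0) at_top"
      using prime_gt_0_nat[OF p] by real_asymp
    then have lim: "((\<lambda>q. exp (- (real q - 1) / real p)) \<longlongrightarrow> 0) ?F" by (rule tendsto_mono[rotated]) simp
    show "((\<lambda>q. ?r q p) \<longlongrightarrow> 0) ?F"
      by (rule tendsto_sandwich[OF _ _ tendsto_const lim])
        (use bounds(3,4)[OF _ p] in \<open>auto simp: eventually_inf_principal intro!: always_eventually\<close>)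
  qed
qed

end
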